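(* For every odd $m\ge3$, $$\operatorname{Aut}(H_m)=\{\mathrm{id},(1\ 2)(3\ 4)\}\cong C_2.$$ The nontrivial automorphism interchanges $\alpha$ with $\beta$ and $\lambda$ with $\mu$, and fixes $\pi$ and $\nu$.
   Context: Let $X=\{1,2,3,4\}$, let $\epsilon:X\to\mathbb Z_2$ be given by $\epsilon(1)=\epsilon(4)=0$, $\epsilon(2)=\epsilon(3)=1$, and let $\eta:\mathbb Z_2\to X$ be $\eta(0)=4$, $\eta(1)=3$. For odd $m\ge3$, $H_m:X^m\to X$ is defined by: $H_m(x_1,\dots,x_m)=1$ if $x_1=\dots=x_m=1$; $=2$ if $x_1=\dots=x_m=2$; and $=\eta(\epsilon(x_1)+\dots+\epsilon(x_m))$ otherwise, with the sum taken in $\mathbb Z_2$. $\operatorname{Aut}(H_m)$ is the group of permutations of $X$ commuting with $H_m$; a permutation acts on equivalence relations of $X$ by taking images. The named equivalences, written as partitions with blocks separated by bars, are $\lambda=1|23|4$, $\mu=14|2|3$, $\nu=1|2|34$, $\alpha=134|2$, $\pi=14|23$, $\beta=1|234$. *)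

theory Defs
  imports "HOL-Library.Z2" "HOL-Library.Disjoint_Sets" "HOL-Combinatorics.Transposition"
    "HOL-Algebra.Sym_Groups" "HOL-Algebra.Elementary_Groups"
begin

definition X :: "nat set" where
  "X = {1..4}"

(* Only the values of eps on X matter. *)
definition eps :: "nat \<Rightarrow> bit" where
  "eps x = (if x = 2 \<or> x = 3 then 1 else 0)"

definition eta :: "bit \<Rightarrow> nat" where
  "eta b = (if b = 0 then 4 else 3)"

(* An m-tuple over X is an extensional function in {1..m} \<rightarrow>\<^sub>E X. *)
definition H :: "nat \<Rightarrow> (nat \<Rightarrow> nat) \<Rightarrow> nat" where
  "H m x =
     (if \<forall>i\<in>{1..m}. x i = 1 then 1
      else if \<forall>i\<in>{1..m}. x i = 2 then 2
      else eta (\<Sum>i=1..m. eps (x i)))"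

(* sym_group 4 consists of the permutations of X = {1..4}, under composition. *)
definition Aut_H :: "nat \<Rightarrow> (nat \<Rightarrow> nat) monoid" where
  "Aut_H m = sym_group 4
     \<lparr>carrier := {p. p permutes X \<and>
        (\<forall>x \<in> {1..m} \<rightarrow>\<^sub>E X. p (H m x) = H m (\<lambda>i\<in>{1..m}. p (x i)))}\<rparr>"

definition rel_of_partition :: "nat set set \<Rightarrow> (nat \<times> nat) set" where
  "rel_of_partition P = {(x, y). \<exists>B\<in>P. x \<in> B \<and> y \<in> B}"

definition act_rel :: "(nat \<Rightarrow> nat) \<Rightarrow> (nat \<times> nat) set \<Rightarrow> (nat \<times> nat) set" where
  "act_rel p R = map_prod p p ` R"

definition eqv_lambda :: "(nat \<times> nat) set" where
  "eqv_lambda = rel_of_partition {{1}, {2, 3}, {4}}"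

definition eqv_mu :: "(nat \<times> nat) set" where
  "eqv_mu = rel_of_partition {{1, 4}, {2}, {3}}"

definition eqv_nu :: "(nat \<times> nat) set" where
  "eqv_nu = rel_of_partition {{1}, {2}, {3, 4}}"

definition eqv_alpha :: "(nat \<times> nat) set" where
  "eqv_alpha = rel_of_partition {{1, 3, 4}, {2}}"

definition eqv_pi :: "(nat \<times> nat) set" where
  "eqv_pi = rel_of_partition {{1, 4}, {2, 3}}"

definition eqv_beta :: "(nat \<times> nat) set" where
  "eqv_beta = rel_of_partition {{1}, {2, 3, 4}}"

lemma X_eq: "X = {1, 2, 3, 4}"
  by (auto simp: X_def)

lemma equiv_named:
  "equiv X eqv_lambda" "equiv X eqv_mu" "equiv X eqv_nu"
  "equiv X eqv_alpha" "equiv X eqv_pi" "equiv X eqv_beta"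
  unfolding eqv_lambda_def eqv_mu_def eqv_nu_def eqv_alpha_def eqv_pi_def eqv_beta_def
    rel_of_partition_def
  by (rule equiv_partition_on; auto simp: X_eq partition_on_def disjoint_def)+

lemma H_in_X: "H m x \<in> X"
  by (auto simp: H_def eta_def X_def)

lemma subgroup_Aut_H: "subgroup (carrier (Aut_H m)) (sym_group 4)"
proof (rule group.subgroupI[OF sym_group_is_group])
  show "carrier (Aut_H m) \<subseteq> carrier (sym_group 4)"
    by (auto simp: Aut_H_def sym_group_def X_def)
next
  have "(\<lambda>i\<in>{1..m}. id (x i)) = x" if "x \<in> {1..m} \<rightarrow>\<^sub>E X" for x
    using that by (auto simp: restrict_def PiE_def extensional_def fun_eq_iff)
  then have "id \<in> carrier (Aut_H m)"
    by (simp add: Aut_H_def permutes_id)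
  then show "carrier (Aut_H m) \<noteq> {}" by blast
next
  fix p assume p: "p \<in> carrier (Aut_H m)"
  then have perm: "p permutes X"
    and comm: "\<And>x. x \<in> {1..m} \<rightarrow>\<^sub>E X \<Longrightarrow> p (H m x) = H m (\<lambda>i\<in>{1..m}. p (x i))"
    by (auto simp: Aut_H_def)
  let ?q = "Hilbert_Choice.inv p"
  have q: "?q permutes X" by (rule permutes_inv[OF perm])
  have "?q (H m x) = H m (\<lambda>i\<in>{1..m}. ?q (x i))" if x: "x \<in> {1..m} \<rightarrow>\<^sub>E X" for x
  proof -
    let ?y = "\<lambda>i\<in>{1..m}. ?q (x i)"
    have y: "?y \<in> {1..m} \<rightarrow>\<^sub>E X"
      using x q by (auto simp: PiE_iff permutes_in_image)
    have "(\<lambda>i\<in>{1..m}. p (?y i)) = x"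
      using x by (auto simp: restrict_def PiE_def extensional_def fun_eq_iff permutes_inverses[OF perm])
    with comm[OF y] have "p (H m ?y) = H m x" by simp
    then show ?thesis by (metis permutes_inverses(2)[OF perm])
  qed
  with q have "?q \<in> carrier (Aut_H m)" by (simp add: Aut_H_def)
  moreover have "p \<in> carrier (sym_group 4)" using perm by (simp add: sym_group_def X_def)
  ultimately show "inv\<^bsub>sym_group 4\<^esub> p \<in> carrier (Aut_H m)" by simp
next
  fix p q assume p: "p \<in> carrier (Aut_H m)" and q: "q \<in> carrier (Aut_H m)"
  have "(p \<circ> q) (H m x) = H m (\<lambda>i\<in>{1..m}. (p \<circ> q) (x i))" if x: "x \<in> {1..m} \<rightarrow>\<^sub>E X" for x
  proof -
    let ?y = "\<lambda>i\<in>{1..m}. q (x i)"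
    have y: "?y \<in> {1..m} \<rightarrow>\<^sub>E X"
      using x q by (auto simp: Aut_H_def PiE_iff permutes_in_image)
    have e: "(\<lambda>i\<in>{1..m}. p (?y i)) = (\<lambda>i\<in>{1..m}. (p \<circ> q) (x i))"
      by (auto simp: restrict_def)
    have "p (H m ?y) = H m (\<lambda>i\<in>{1..m}. p (?y i))" using p y unfolding Aut_H_def by simp
    moreover have "q (H m x) = H m ?y" using q x by (simp add: Aut_H_def)
    ultimately have "(p \<circ> q) (H m x) = H m (\<lambda>i\<in>{1..m}. p (?y i))"
      by (simp only: o_apply)
    then show ?thesis by (simp only: e)
  qed
  then show "p \<otimes>\<^bsub>sym_group 4\<^esub> q \<in> carrier (Aut_H m)"
    using p q by (simp add: Aut_H_def sym_group_def permutes_compose)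
qed

end

theory Submission
  imports Defs
begin

text \<open>
  On a tuple \<open>(a, b, \<dots>, b)\<close> with \<open>a \<noteq> b\<close> the operation takes the value \<open>\<eta> (\<epsilon> a)\<close>, since \<open>m - 1\<close> is
  even. So an automorphism commutes with \<open>\<eta> \<circ> \<epsilon>\<close>, whose image is \<open>{3, 4}\<close>, and this leaves only
  the two permutations. That \<open>(1 2)(3 4)\<close> is an automorphism holds because it adds \<open>1\<close> to each
  \<open>\<epsilon>\<close>, hence \<open>1\<close> to the sum in \<open>\<int>\<^sub>2\<close> of an odd number of them.
\<close>

abbreviation swap :: "nat \<Rightarrow> nat" where
  "swap \<equiv> transpose 1 2 \<circ> transpose 3 4"

lemma of_nat_bit: "(of_nat n :: bit) = of_bool (odd n)"
  by (induction n) simp_all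

lemma H_fun_upd_const:
  assumes "odd m" and "m \<ge> 3" and "a \<noteq> b"
  shows "H m (\<lambda>i\<in>{1..m}. if i = 1 then a else b) = eta (eps a)"
proof -
  let ?x = "\<lambda>i\<in>{1..m}. if i = 1 then a else b"
  have x: "?x 1 = a" "?x 2 = b"
    using assms by auto
  \<comment> \<open>Indices 1 and 2 carry different entries, so neither constant case of
    \<open>H\<close> applies.\<close>
  have nonconst: "(\<forall>i\<in>{1..m}. ?x i = c) = False" for c
  proof -
    have "1 \<in> {1..m}" "2 \<in> {1..m}"
      using assms by simp_all
    with x \<open>a \<noteq> b\<close> show ?thesis
      by metis
  qed
  have "(\<Sum>i=1..m. eps (?x i)) = eps (?x 1) + (\<Sum>i=Suc 1..m. eps (?x i))"
    using assms by (intro sum.atLeast_Suc_atMost) simp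
  also have "(\<Sum>i=Suc 1..m. eps (?x i)) = (\<Sum>i=Suc 1..m. eps b)"
    by (intro sum.cong refl) simp
  also have "\<dots> = 0"
    using \<open>odd m\<close> by (simp add: of_nat_bit)
  finally show ?thesis
    by (simp only: H_def nonconst if_False x add_0_right)
qed

lemma eta_add_1: "eta (b + 1) = swap (eta b)"
  by (cases b) (auto simp: eta_def transpose_def)

lemma eps_swap: "a \<in> X \<Longrightarrow> eps (swap a) = eps a + 1"
  by (auto simp: X_eq eps_def transpose_def)

lemma swap_permutes: "swap permutes X"
  by (rule permutes_compose; rule permutes_swap_id; simp add: X_eq)

lemma swap_H:
  assumes "odd m" and x: "x \<in> {1..m} \<rightarrow>\<^sub>E X"
  shows "swap (H m x) = H m (\<lambda>i\<in>{1..m}. swap (x i))"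
proof -
  have "(\<Sum>i=1..m. eps (swap (x i))) = (\<Sum>i=1..m. eps (x i) + 1)"
    using x by (intro sum.cong refl eps_swap) auto
  also have "\<dots> = (\<Sum>i=1..m. eps (x i)) + 1"
    using \<open>odd m\<close> by (simp only: sum.distrib) (simp add: of_nat_bit)
  finally have "eta (\<Sum>i=1..m. eps (swap (x i))) = swap (eta (\<Sum>i=1..m. eps (x i)))"
    by (simp only: eta_add_1)
  \<comment> \<open>The two constant cases of \<open>H\<close> are exchanged by \<open>swap\<close>;
    as the index set is nonempty, they exclude each other.\<close>
  moreover have "swap a = 1 \<longleftrightarrow> a = 2" "swap a = 2 \<longleftrightarrow> a = 1" for a
    by (auto simp: transpose_def)
  moreover have "1 \<in> {1..m}"
    using assms by (cases m) auto
  ultimately show ?thesis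
    unfolding H_def by (auto simp: transpose_def)
qed

lemma automorphism_cases:
  assumes "odd m" and "m \<ge> 3" and p: "p permutes X"
    and comm: "\<And>x. x \<in> {1..m} \<rightarrow>\<^sub>E X \<Longrightarrow> p (H m x) = H m (\<lambda>i\<in>{1..m}. p (x i))"
  shows "p = id \<or> p = swap"
proof -
  have inj: "p a = p b \<longleftrightarrow> a = b" for a b
    using permutes_inj[OF p] by (simp add: inj_eq)
  \<comment> \<open>The entry \<open>b\<close> only makes the tuple nonconstant. Injectivity of
    \<open>p\<close> gives \<open>p a \<noteq> p b\<close>, so the image tuple has the same
    shape.\<close>
  have *: "p (eta (eps a)) = eta (eps (p a))" if "a \<in> X" "b \<in> X" "a \<noteq> b" for a b
  proof -
    let ?x = "\<lambda>i\<in>{1..m}. if i = 1 then a else b"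
    have "(\<lambda>i\<in>{1..m}. p (?x i)) = (\<lambda>i\<in>{1..m}. if i = 1 then p a else p b)"
      by auto
    with comm[of ?x] that show ?thesis
      using H_fun_upd_const[OF assms(1,2), of a b] H_fun_upd_const[OF assms(1,2), of "p a" "p b"]
      by (auto simp: inj)
  qed
  have in_X: "p a \<in> {1, 2, 3, 4}" if "a \<in> {1, 2, 3, 4}" for a
    using permutes_in_image[OF p] that by (simp add: X_eq)
  \<comment> \<open>Both values lie in {3, 4}, so \<open>p\<close> preserves {3, 4} and hence {1,
    2}. The first equation then ties \<open>p 4\<close> to \<open>p 1\<close>:
    \<open>p 1 = 1\<close> forces \<open>p 4 = 4\<close>, and \<open>p 1 = 2\<close> forces
    \<open>p 4 = 3\<close>.\<close>
  have "p 4 = eta (eps (p 1))" "p 3 = eta (eps (p 2))"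
    using *[of 1 2] *[of 2 1] by (simp_all add: eta_def eps_def X_eq)
  then consider "p 1 = 1 \<and> p 2 = 2 \<and> p 3 = 3 \<and> p 4 = 4" | "p 1 = 2 \<and> p 2 = 1 \<and> p 3 = 4 \<and> p 4 = 3"
    using in_X[of 1] in_X[of 2] inj[of 1 2] inj[of 1 3] inj[of 1 4] inj[of 2 3] inj[of 2 4] inj[of 3 4]
    by (auto simp: eta_def eps_def)
  then show ?thesis
  proof cases
    case 1
    have "p a = id a" for a
      using 1 permutes_not_in[OF p, of a] by (cases "a \<in> X") (auto simp: X_eq)
    then show ?thesis by blast
  next
    case 2
    have "p a = swap a" for a
      using 2 permutes_not_in[OF p, of a] permutes_not_in[OF swap_permutes, of a]
      by (cases "a \<in> X") (auto simp: X_eq transpose_def)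
    then show ?thesis by blast
  qed
qed

lemma carrier_Aut_H:
  assumes "odd m" and "m \<ge> 3"
  shows "carrier (Aut_H m) = {id, swap}"
proof
  show "carrier (Aut_H m) \<subseteq> {id, swap}"
    using automorphism_cases[OF assms] by (auto simp: Aut_H_def)
  have "id \<in> carrier (Aut_H m)"
    using subgroup.one_closed[OF subgroup_Aut_H] by (simp add: sym_group_def)
  then show "{id, swap} \<subseteq> carrier (Aut_H m)"
    using swap_permutes swap_H[OF assms(1)] by (simp add: Aut_H_def)
qed

lemma swap_swap: "swap \<circ> swap = id"
  by (auto simp: fun_eq_iff transpose_def)

lemma swap_neq_id: "swap \<noteq> id"
  by (auto simp: fun_eq_iff transpose_def)

lemma Aut_H_iso:
  assumes "odd m" and "m \<ge> 3"
  shows "Aut_H m \<cong> integer_mod_group 2"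
proof (rule is_isoI)
  have mult: "p \<otimes>\<^bsub>Aut_H m\<^esub> q = p \<circ> q" for p q
    by (simp add: Aut_H_def sym_group_def)
  have "{0..<2::int} = {0, 1}"
    by auto
  \<comment> \<open>The only product without an identity factor is
    \<open>swap \<circ> swap = id\<close>, matching 1 + 1 = 0 modulo 2.\<close>
  then show "(\<lambda>p. if p = id then 0 else 1) \<in> iso (Aut_H m) (integer_mod_group 2)"
    using swap_neq_id swap_swap
    by (auto simp: iso_def hom_def bij_betw_def carrier_Aut_H[OF assms] mult
        carrier_integer_mod_group integer_mod_group_def)
qed

lemma act_rel_rel_of_partition:
  assumes "inj p"
  shows "act_rel p (rel_of_partition P) = rel_of_partition ((`) p ` P)"
  using assms unfolding act_rel_def rel_of_partition_def by (auto simp: image_iff inj_eq)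

lemma act_rel_swap:
  "act_rel swap eqv_alpha = eqv_beta" "act_rel swap eqv_beta = eqv_alpha"
  "act_rel swap eqv_lambda = eqv_mu" "act_rel swap eqv_mu = eqv_lambda"
  "act_rel swap eqv_pi = eqv_pi" "act_rel swap eqv_nu = eqv_nu"
  unfolding eqv_lambda_def eqv_mu_def eqv_nu_def eqv_alpha_def eqv_pi_def eqv_beta_def
    act_rel_rel_of_partition[OF permutes_inj[OF swap_permutes]]
  by (simp_all add: transpose_def insert_commute)

theorem corollary6p4:
  fixes m :: nat
  assumes "odd m" and "m \<ge> 3"
  shows "carrier (Aut_H m) = {id, transpose 1 2 \<circ> transpose 3 4}
    \<and> Aut_H m \<cong> integer_mod_group 2
    \<and> (\<forall>\<sigma> \<in> carrier (Aut_H m) - {id}.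
          act_rel \<sigma> eqv_alpha = eqv_beta \<and> act_rel \<sigma> eqv_beta = eqv_alpha
        \<and> act_rel \<sigma> eqv_lambda = eqv_mu \<and> act_rel \<sigma> eqv_mu = eqv_lambda
        \<and> act_rel \<sigma> eqv_pi = eqv_pi \<and> act_rel \<sigma> eqv_nu = eqv_nu)"
  using act_rel_swap Aut_H_iso[OF assms] unfolding carrier_Aut_H[OF assms] by blast

end
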